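(* Let $\mathbb F$ be an algebraically closed field with $\operatorname{char}\mathbb F=2$. Consider the following list of 3-dimensional nilpotent associative $\mathbb F$-algebras: $\mathfrak a_0$, $\mathfrak c_1$, $\mathfrak c_3$, $\mathfrak l_1$, $\mathfrak c_5$ and $\mathfrak a(\delta)$ for $\delta\in\mathbb F$ (defined in the context). For two distinct members $\mathfrak g,\mathfrak h$ of this list, $\mathfrak g$ degenerates to $\mathfrak h$ if and only if $(\mathfrak g,\mathfrak h)$ is one of the following pairs: (1) $(\mathfrak c_5,\mathfrak c_3)$, $(\mathfrak c_5,\mathfrak l_1)$, $(\mathfrak c_5,\mathfrak c_1)$, $(\mathfrak c_5,\mathfrak a_0)$; (2) $(\mathfrak c_3,\mathfrak l_1)$, $(\mathfrak c_3,\mathfrak c_1)$, $(\mathfrak c_3,\mathfrak a_0)$; (3) $(\mathfrak a(\delta),\mathfrak c_1)$, $(\mathfrak a(\delta),\mathfrak a_0)$ for any $\delta\in\mathbb F$; (4) $(\mathfrak c_1,\mathfrak a_0)$, $(\mathfrak l_1,\mathfrak a_0)$.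
   Context: Let $V$ be a 3-dimensional $\mathbb F$-vector space with a fixed ordered basis $(e_1,e_2,e_3)$. An algebra structure on $V$ is an $\mathbb F$-algebra with underlying space $V$, given by an arbitrary $\mathbb F$-bilinear product $V\times V\to V$. It is associative if $(uv)w=u(vw)$ for all $u,v,w$, and nilpotent if for some $r\ge 1$ all left-normed products $(\cdots((w_1w_2)w_3)\cdots)w_{r+1}$ vanish. The structure vector of an algebra structure $\mathfrak g$ relative to an ordered basis $(u_1,u_2,u_3)$ of $V$ is $(\gamma_{ijk})_{1\le i,j,k\le 3}\in\mathbb F^{27}$, where $u_iu_j=\sum_k\gamma_{ijk}u_k$. Let $\Lambda=\mathbb F^{27}$ with the Zariski topology, and let $\Theta(\mathfrak g)\in\Lambda$ be the structure vector of $\mathfrak g$ relative to $(e_1,e_2,e_3)$; $\Theta$ is a bijection from algebra structures on $V$ to $\Lambda$. The group $G=\mathrm{GL}(3,\mathbb F)$ acts on $\Lambda$ on the right by change of basis: $\lambda g$ is the structure vector of $\Theta^{-1}(\lambda)$ relative to the basis $v_j=\sum_i g_{ij}e_i$ ($j=1,2,3$). Write $O(\lambda)=\lambda G$ for the orbit; orbits correspond to isomorphism classes of algebras. One says $\mathfrak g$ degenerates to $\mathfrak h$ if $\Theta(\mathfrak h)\in\overline{O(\Theta(\mathfrak g))}$ (Zariski closure). The algebras are given by their nonzero products of basis vectors (all other products of basis vectors being zero): $\mathfrak a_0$: none (zero algebra); $\mathfrak c_1$: $e_3e_3=e_1$; $\mathfrak c_3$: $e_2e_2=e_1$, $e_3e_3=e_1$;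 $\mathfrak a(\delta)$, $\delta\in\mathbb F$: $e_2e_2=e_1$, $e_3e_3=\delta e_1$, $e_2e_3=e_1$; $\mathfrak l_1$: $e_2e_3=e_1$, $e_3e_2=-e_1$; $\mathfrak c_5$: $e_1e_1=e_2$, $e_1e_2=e_3$, $e_2e_1=e_3$. By the known classification, over an algebraically closed field every 3-dimensional nilpotent associative algebra is isomorphic to exactly one algebra in this list (distinct $\delta$ giving non-isomorphic $\mathfrak a(\delta)$). *)

theory Defs
  imports "HOL-Analysis.Analysis" "HOL-Computational_Algebra.Polynomial" "HOL-Library.Poly_Mapping"
begin

section \<open>Zariski closure in affine space\<close>

text \<open>A polynomial in the finitely many variables indexed by \<open>'i\<close> is a finitely supported
  family of coefficients, indexed by the exponent vectors.\<close>

type_synonym ('i, 'a) mpoly = "('i \<Rightarrow>\<^sub>0 nat) \<Rightarrow>\<^sub>0 'a"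

definition mpoly_eval :: "('i::finite, 'a::comm_ring_1) mpoly \<Rightarrow> ('i \<Rightarrow> 'a) \<Rightarrow> 'a" where
  "mpoly_eval p x =
     (\<Sum>m\<in>Poly_Mapping.keys p. Poly_Mapping.lookup p m * (\<Prod>i\<in>UNIV. x i ^ Poly_Mapping.lookup m i))"

definition zariski_closed :: "('i::finite \<Rightarrow> 'a::comm_ring_1) set \<Rightarrow> bool" where
  "zariski_closed Z \<longleftrightarrow> (\<exists>P. Z = {x. \<forall>p\<in>P. mpoly_eval p x = 0})"

abbreviation zariski_closure :: "('i::finite \<Rightarrow> 'a::comm_ring_1) set \<Rightarrow> ('i \<Rightarrow> 'a) set" where
  "zariski_closure S \<equiv> zariski_closed hull S"


section \<open>Algebra structures on a 3-dimensional space with a fixed ordered basis\<close>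

text \<open>The index type \<open>3\<close> has the elements \<open>1, 2, 3\<close>
  (with \<open>3 = 0\<close>, which plays no role here).\<close>

type_synonym 'a structure_constants = "3 \<times> 3 \<times> 3 \<Rightarrow> 'a"

locale based_space = vector_space scale
  for scale :: "'a::field \<Rightarrow> 'v::ab_group_add \<Rightarrow> 'v" (infixr \<open>\<odot>\<close> 75) +
  fixes e :: "3 \<Rightarrow> 'v"
  assumes inj_e: "inj e"
    and independent_e: "independent (range e)"
    and span_e: "span (range e) = UNIV"
begin

definition algebra_structure :: "('v \<Rightarrow> 'v \<Rightarrow> 'v) \<Rightarrow> bool" where
  "algebra_structure \<mu> \<longleftrightarrow>
     (\<forall>u. Vector_Spaces.linear (\<odot>) (\<odot>) (\<lambda>v. \<mu> u v)) \<and>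
     (\<forall>v. Vector_Spaces.linear (\<odot>) (\<odot>) (\<lambda>u. \<mu> u v))"

definition associative :: "('v \<Rightarrow> 'v \<Rightarrow> 'v) \<Rightarrow> bool" where
  "associative \<mu> \<longleftrightarrow> (\<forall>u v w. \<mu> (\<mu> u v) w = \<mu> u (\<mu> v w))"

definition nilpotent :: "('v \<Rightarrow> 'v \<Rightarrow> 'v) \<Rightarrow> bool" where
  "nilpotent \<mu> \<longleftrightarrow> (\<exists>r\<ge>1. \<forall>w ws. length ws = r \<longrightarrow> foldl \<mu> w ws = 0)"

text \<open>Meaningful only if \<open>u\<close> is injective with linearly independent range.\<close>

definition coord :: "(3 \<Rightarrow> 'v) \<Rightarrow> 'v \<Rightarrow> 3 \<Rightarrow> 'a" where
  "coord u v i = representation (range u) v (u i)"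

definition structure_vector :: "(3 \<Rightarrow> 'v) \<Rightarrow> ('v \<Rightarrow> 'v \<Rightarrow> 'v) \<Rightarrow> 'a structure_constants" where
  "structure_vector u \<mu> = (\<lambda>(i, j, k). coord u (\<mu> (u i) (u j)) k)"

definition \<Theta> :: "('v \<Rightarrow> 'v \<Rightarrow> 'v) \<Rightarrow> 'a structure_constants" where
  "\<Theta> \<mu> = structure_vector e \<mu>"

definition \<Theta>_inv :: "'a structure_constants \<Rightarrow> 'v \<Rightarrow> 'v \<Rightarrow> 'v" where
  "\<Theta>_inv = the_inv_into {\<mu>. algebra_structure \<mu>} \<Theta>"

definition change_basis :: "'a^3^3 \<Rightarrow> 3 \<Rightarrow> 'v" where
  "change_basis g j = (\<Sum>i\<in>UNIV. (g $ i $ j) \<odot> e i)"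

definition act :: "'a structure_constants \<Rightarrow> 'a^3^3 \<Rightarrow> 'a structure_constants" where
  "act \<gamma> g = structure_vector (change_basis g) (\<Theta>_inv \<gamma>)"

definition orbit :: "'a structure_constants \<Rightarrow> 'a structure_constants set" where
  "orbit \<gamma> = {act \<gamma> g | g. invertible g}"

definition degenerates :: "('v \<Rightarrow> 'v \<Rightarrow> 'v) \<Rightarrow> ('v \<Rightarrow> 'v \<Rightarrow> 'v) \<Rightarrow> bool" where
  "degenerates \<mu> \<nu> \<longleftrightarrow> \<Theta> \<nu> \<in> zariski_closure (orbit (\<Theta> \<mu>))"

definition bilinear_extension :: "(3 \<Rightarrow> 3 \<Rightarrow> 'v) \<Rightarrow> 'v \<Rightarrow> 'v \<Rightarrow> 'v" where
  "bilinear_extension p u v = (\<Sum>i\<in>UNIV. \<Sum>j\<in>UNIV. (coord e u i * coord e v j) \<odot> p i j)"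

definition alg_a0 :: "'v \<Rightarrow> 'v \<Rightarrow> 'v" where
  "alg_a0 = bilinear_extension (\<lambda>i j. 0)"

definition alg_c1 :: "'v \<Rightarrow> 'v \<Rightarrow> 'v" where
  "alg_c1 = bilinear_extension (\<lambda>i j. if (i, j) = (3, 3) then e 1 else 0)"

definition alg_c3 :: "'v \<Rightarrow> 'v \<Rightarrow> 'v" where
  "alg_c3 = bilinear_extension (\<lambda>i j.
     if (i, j) = (2, 2) then e 1 else if (i, j) = (3, 3) then e 1 else 0)"

definition alg_a :: "'a \<Rightarrow> 'v \<Rightarrow> 'v \<Rightarrow> 'v" where
  "alg_a \<delta> = bilinear_extension (\<lambda>i j.
     if (i, j) = (2, 2) then e 1 else if (i, j) = (3, 3) then \<delta> \<odot> e 1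
     else if (i, j) = (2, 3) then e 1 else 0)"

definition alg_l1 :: "'v \<Rightarrow> 'v \<Rightarrow> 'v" where
  "alg_l1 = bilinear_extension (\<lambda>i j.
     if (i, j) = (2, 3) then e 1 else if (i, j) = (3, 2) then - e 1 else 0)"

definition alg_c5 :: "'v \<Rightarrow> 'v \<Rightarrow> 'v" where
  "alg_c5 = bilinear_extension (\<lambda>i j.
     if (i, j) = (1, 1) then e 2 else if (i, j) = (1, 2) then e 3
     else if (i, j) = (2, 1) then e 3 else 0)"

definition algebra_list :: "('v \<Rightarrow> 'v \<Rightarrow> 'v) set" where
  "algebra_list = {alg_a0, alg_c1, alg_c3, alg_l1, alg_c5} \<union> range alg_a"


subsection \<open>Consistency of the definitions\<close>

lemma coord_add: "coord e (u + v) i = coord e u i + coord e v i"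
  using representation_add[OF independent_e, of v u] span_e by (simp add: coord_def)

lemma coord_scale: "coord e (c \<odot> v) i = c * coord e v i"
  using representation_scale[OF independent_e, of v c] span_e by (simp add: coord_def)

lemma coord_diff: "coord e (u - v) i = coord e u i - coord e v i"
  using representation_diff[OF independent_e, of v u] span_e by (simp add: coord_def)

lemma coord_zero: "coord e 0 i = 0"
  by (simp add: coord_def representation_zero)

lemma coord_basis: "coord e (e j) i = (if i = j then 1 else 0)"
  using representation_basis[OF independent_e, of "e j"] inj_e
  by (auto simp: coord_def inj_def)

lemma coord_sum: "coord e (sum f A) i = (\<Sum>x\<in>A. coord e (f x) i)"
  by (induction A rule: infinite_finite_induct) (auto simp: coord_add coord_zero)

lemma coord_expand: "(\<Sum>i\<in>UNIV. coord e v i \<odot> e i) = v"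
  using sum_representation_eq[OF independent_e, of v "range e"] span_e inj_e
  by (simp add: coord_def sum.reindex)

lemma algebra_structure_bilinear_extension: "algebra_structure (bilinear_extension p)"
  unfolding algebra_structure_def bilinear_extension_def
  by (simp add: Vector_Spaces.linear_iff vector_space_axioms coord_add coord_scale
      distrib_left distrib_right scale_left_distrib sum.distrib scale_sum_right mult_ac)

lemma bilinear_extension_basis: "bilinear_extension p (e i) (e j) = p i j"
  by (simp add: bilinear_extension_def coord_basis if_distrib[of "\<lambda>c. c * _"]
      if_distrib[of "\<lambda>c. scale c _"] if_distrib[of "(*) _"] cong: if_cong)

lemma algebra_structure_eq_bilinear_extension:
  assumes "algebra_structure \<mu>"
  shows "\<mu> = bilinear_extension (\<lambda>i j. \<mu> (e i) (e j))"
proof (intro ext)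
  fix u v
  have l1: "Vector_Spaces.linear (\<odot>) (\<odot>) (\<mu> u)" for u
    using assms by (auto simp: algebra_structure_def)
  have l2: "Vector_Spaces.linear (\<odot>) (\<odot>) (\<lambda>u. \<mu> u v)" for v
    using assms by (auto simp: algebra_structure_def)
  interpret r: Vector_Spaces.linear "(\<odot>)" "(\<odot>)" "\<mu> u" for u by (rule l1)
  interpret l: Vector_Spaces.linear "(\<odot>)" "(\<odot>)" "\<lambda>u. \<mu> u v" for v by (rule l2)
  have "\<mu> u v = \<mu> (\<Sum>i\<in>UNIV. coord e u i \<odot> e i) (\<Sum>j\<in>UNIV. coord e v j \<odot> e j)"
    by (simp add: coord_expand)
  also have "\<dots> = (\<Sum>i\<in>UNIV. coord e u i \<odot> (\<Sum>j\<in>UNIV. coord e v j \<odot> \<mu> (e i) (e j)))"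
    by (subst l.sum) (simp add: l.scale r.sum r.scale scale_sum_right mult.commute)
  also have "\<dots> = bilinear_extension (\<lambda>i j. \<mu> (e i) (e j)) u v"
    by (simp add: bilinear_extension_def scale_sum_right)
  finally show "\<mu> u v = bilinear_extension (\<lambda>i j. \<mu> (e i) (e j)) u v" .
qed

lemma bij_betw_\<Theta>: "bij_betw \<Theta> {\<mu>. algebra_structure \<mu>} UNIV"
proof (rule bij_betw_imageI)
  show "inj_on \<Theta> {\<mu>. algebra_structure \<mu>}"
  proof (rule inj_onI, clarify)
    fix \<mu> \<nu> assume *: "algebra_structure \<mu>" "algebra_structure \<nu>" "\<Theta> \<mu> = \<Theta> \<nu>"
    have "coord e (\<mu> (e i) (e j)) k = coord e (\<nu> (e i) (e j)) k" for i j k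
      using fun_cong[OF *(3), of "(i, j, k)"] by (simp add: \<Theta>_def structure_vector_def)
    then have "(\<Sum>k\<in>UNIV. coord e (\<mu> (e i) (e j)) k \<odot> e k)
        = (\<Sum>k\<in>UNIV. coord e (\<nu> (e i) (e j)) k \<odot> e k)" for i j
      by simp
    then have "(\<lambda>i j. \<mu> (e i) (e j)) = (\<lambda>i j. \<nu> (e i) (e j))"
      by (simp only: coord_expand)
    then show "\<mu> = \<nu>"
      by (metis algebra_structure_eq_bilinear_extension *(1,2))
  qed
  show "\<Theta> ` {\<mu>. algebra_structure \<mu>} = UNIV"
  proof (intro set_eqI iffI UNIV_I)
    fix \<gamma> :: "'a structure_constants"
    let ?\<mu> = "bilinear_extension (\<lambda>i j. \<Sum>k\<in>UNIV. \<gamma> (i, j, k) \<odot> e k)"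
    have "\<Theta> ?\<mu> = \<gamma>"
      by (auto simp: \<Theta>_def structure_vector_def bilinear_extension_basis coord_sum coord_scale
          coord_basis if_distrib[of "(*) _"] cong: if_cong)
    then show "\<gamma> \<in> \<Theta> ` {\<mu>. algebra_structure \<mu>}"
      by (intro image_eqI[of _ _ ?\<mu>]) (simp_all add: algebra_structure_bilinear_extension)
  qed
qed

lemma algebra_list_nilpotent_associative:
  assumes "\<mu> \<in> algebra_list"
  shows "algebra_structure \<mu>" "associative \<mu>" "nilpotent \<mu>"
proof -
  note defs = alg_a0_def alg_c1_def alg_c3_def alg_a_def alg_l1_def alg_c5_def
  show "algebra_structure \<mu>"
    using assms by (auto simp: algebra_list_def defs algebra_structure_bilinear_extension)
  note simps = defs bilinear_extension_def sum_3 coord_add coord_scale coord_zero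
    coord_basis coord_diff
  have zero: "\<mu> (\<mu> u v) w = 0 \<and> \<mu> u (\<mu> v w) = 0" if "\<mu> \<noteq> alg_c5" for u v w
    using assms that unfolding algebra_list_def by (auto simp: simps)
  have c5: "alg_c5 u v = (coord e u 1 * coord e v 1) \<odot> e 2
      + (coord e u 1 * coord e v 2 + coord e u 2 * coord e v 1) \<odot> e 3" for u v
    by (simp add: simps algebra_simps)
  show "associative \<mu>"
  proof (cases "\<mu> = alg_c5")
    case True
    then show ?thesis
      by (simp add: associative_def c5 coord_add coord_scale coord_basis mult_ac)
  qed (use zero in \<open>simp add: associative_def\<close>)
  have "foldl \<mu> w ws = 0" if len: "length ws = 3" for w ws
  proof -
    obtain x y z where ws: "ws = [x, y, z]"
      using len by (auto simp: length_Suc_conv numeral_3_eq_3)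
    show ?thesis
    proof (cases "\<mu> = alg_c5")
      case True
      then show ?thesis
        by (simp add: ws c5 coord_add coord_scale coord_basis)
    qed (use zero[of "\<mu> w x" y z] in \<open>simp add: ws\<close>)
  qed
  then show "nilpotent \<mu>"
    unfolding nilpotent_def by (intro exI[of _ 3]) auto
qed

end

end

theory Submission
  imports Defs
begin

text \<open>Each degeneration is realised by bases depending polynomially on \<open>t \<noteq> 0\<close> whose
  structure constants are polynomials in \<open>t\<close> and specialise at \<open>t = 0\<close> to the target algebra.
  Each non-degeneration follows from a polynomial identity that holds on the whole orbit and fails
  at the target. Apart from \<open>\<cc>\<^sub>5\<close>, every product in the list is \<open>B(u, v) w\<close>, with \<open>B\<close> a
  bilinear form and \<open>w\<close> a fixed vector, and this makes the structure vector satisfy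
  \<open>\<gamma>\<^sub>i\<^sub>j\<^sub>k \<gamma>\<^sub>l\<^sub>m\<^sub>n = \<gamma>\<^sub>i\<^sub>j\<^sub>n \<gamma>\<^sub>l\<^sub>m\<^sub>k\<close>, which fails for \<open>\<cc>\<^sub>5\<close>.
  Symmetry of \<open>B\<close>, its being alternating, and the ratio of its determinant to the square
  of its skew part are also closed conditions; in characteristic 2 the form of \<open>\<ll>\<^sub>1\<close> is
  both alternating and symmetric, hence a limit of the form of \<open>\<cc>\<^sub>3\<close>.\<close>

section \<open>Polynomial functions on affine space\<close>

definition polynomial_function :: "(('i::finite \<Rightarrow> 'a::comm_ring_1) \<Rightarrow> 'a) \<Rightarrow> bool" where
  "polynomial_function F \<longleftrightarrow> (\<exists>p. \<forall>x. mpoly_eval p x = F x)"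

text \<open>Terms may cancel in \<open>p + q\<close>, so additivity needs all three sums over one
  common finite set of exponents.\<close>

lemma mpoly_eval_superset:
  assumes "finite S" "Poly_Mapping.keys p \<subseteq> S"
  shows "mpoly_eval p x =
    (\<Sum>m\<in>S. Poly_Mapping.lookup p m * (\<Prod>i\<in>UNIV. x i ^ Poly_Mapping.lookup m i))"
  unfolding mpoly_eval_def
  by (rule sum.mono_neutral_left) (use assms in \<open>auto simp: in_keys_iff\<close>)

lemma mpoly_eval_add: "mpoly_eval (p + q) x = mpoly_eval p x + mpoly_eval q x"
proof -
  let ?S = "Poly_Mapping.keys p \<union> Poly_Mapping.keys q"
  have "mpoly_eval (p + q) x =
      (\<Sum>m\<in>?S. Poly_Mapping.lookup (p + q) m * (\<Prod>i\<in>UNIV. x i ^ Poly_Mapping.lookup m i))"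
    by (rule mpoly_eval_superset) (simp_all add: Poly_Mapping.keys_add)
  also have "\<dots> = mpoly_eval p x + mpoly_eval q x"
    by (simp add: mpoly_eval_superset[of ?S] lookup_add distrib_right sum.distrib)
  finally show ?thesis .
qed

lemma polynomial_function_monomial:
  "polynomial_function (\<lambda>x. c * (\<Prod>i\<in>UNIV. x i ^ Poly_Mapping.lookup m i))"
proof -
  have "mpoly_eval (Poly_Mapping.single m c) x = c * (\<Prod>i\<in>UNIV. x i ^ Poly_Mapping.lookup m i)" for x
    by (subst mpoly_eval_superset[of "{m}"]) auto
  then show ?thesis
    unfolding polynomial_function_def by blast
qed

lemma polynomial_function_const: "polynomial_function (\<lambda>x. c)"
  using polynomial_function_monomial[of c 0] by simp

lemma polynomial_function_coordinate:
  "polynomial_function (\<lambda>x :: 'i::finite \<Rightarrow> 'a::comm_ring_1. x i)"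
proof -
  have "(\<Prod>j\<in>UNIV. x j ^ Poly_Mapping.lookup (Poly_Mapping.single i 1) j) = x i"
    for x :: "'i \<Rightarrow> 'a"
    by (simp add: lookup_single when_def if_distrib[of "(^) _"] cong: if_cong)
  then show ?thesis
    using polynomial_function_monomial[of "1 :: 'a" "Poly_Mapping.single i 1"] by simp
qed

lemma polynomial_function_add:
  "polynomial_function F \<Longrightarrow> polynomial_function G \<Longrightarrow> polynomial_function (\<lambda>x. F x + G x)"
  unfolding polynomial_function_def by (metis mpoly_eval_add)

lemma polynomial_function_sum:
  "(\<And>s. s \<in> S \<Longrightarrow> polynomial_function (F s)) \<Longrightarrow> polynomial_function (\<lambda>x. \<Sum>s\<in>S. F s x)"
  by (induction S rule: infinite_finite_induct)
    (auto simp: polynomial_function_const polynomial_function_add)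

text \<open>The product expands into a double sum of monomials whose exponents add, so closure under
  sums suffices.\<close>

lemma polynomial_function_mult:
  assumes "polynomial_function F" "polynomial_function G"
  shows "polynomial_function (\<lambda>x. F x * G x)"
proof -
  obtain p q where pq: "\<And>x. F x = mpoly_eval p x" "\<And>x. G x = mpoly_eval q x"
    using assms unfolding polynomial_function_def by metis
  have "polynomial_function (\<lambda>x. \<Sum>m\<in>Poly_Mapping.keys p. \<Sum>n\<in>Poly_Mapping.keys q.
      (Poly_Mapping.lookup p m * Poly_Mapping.lookup q n) *
      (\<Prod>i\<in>UNIV. x i ^ Poly_Mapping.lookup (m + n) i))"
    by (intro polynomial_function_sum polynomial_function_monomial)
  also have "(\<lambda>x. \<Sum>m\<in>Poly_Mapping.keys p. \<Sum>n\<in>Poly_Mapping.keys q.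
      (Poly_Mapping.lookup p m * Poly_Mapping.lookup q n) *
      (\<Prod>i\<in>UNIV. x i ^ Poly_Mapping.lookup (m + n) i)) = (\<lambda>x. F x * G x)"
    by (rule ext)
      (simp add: pq mpoly_eval_def sum_product lookup_add power_add prod.distrib mult_ac)
  finally show ?thesis .
qed

lemma polynomial_function_diff:
  assumes "polynomial_function F" "polynomial_function G"
  shows "polynomial_function (\<lambda>x. F x - G x)"
  using polynomial_function_add[OF assms(1)
      polynomial_function_mult[OF polynomial_function_const[of "-1"] assms(2)]]
  by simp

lemmas polynomial_function_intros = polynomial_function_const polynomial_function_coordinate
  polynomial_function_add polynomial_function_diff polynomial_function_mult

section \<open>Zariski closure: identities and curves\<close>

text \<open>The zero set of \<open>F - G\<close> is Zariski closed and contains \<open>S\<close>,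
  hence contains the hull.\<close>

lemma polynomial_eq_on_zariski_closure:
  assumes "x \<in> zariski_closure S" "polynomial_function F" "polynomial_function G"
    and "\<And>y. y \<in> S \<Longrightarrow> F y = G y"
  shows "F x = G x"
proof -
  obtain p where p: "\<And>x. mpoly_eval p x = F x - G x"
    using polynomial_function_diff[OF assms(2,3)] unfolding polynomial_function_def by blast
  have "zariski_closed {x. \<forall>q\<in>{p}. mpoly_eval q x = 0}"
    unfolding zariski_closed_def by blast
  moreover have "S \<subseteq> {x. \<forall>q\<in>{p}. mpoly_eval q x = 0}"
    using assms(4) by (auto simp: p)
  ultimately have "zariski_closure S \<subseteq> {x. \<forall>q\<in>{p}. mpoly_eval q x = 0}"
    by (rule hull_minimal[rotated])
  then show ?thesis
    using assms(1) by (auto simp: p)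
qed

text \<open>A polynomial in \<open>t\<close> vanishing for all \<open>t \<noteq> 0\<close> is zero over an infinite field, so a
  polynomial curve cannot leave a Zariski closed set at \<open>t = 0\<close>.\<close>

lemma polynomial_curve_limit_in_zariski_closure:
  fixes S :: "('i::finite \<Rightarrow> 'a::field) set"
  assumes inf: "infinite (UNIV :: 'a set)"
    and curve: "\<And>t. t \<noteq> 0 \<Longrightarrow> (\<lambda>i. poly (L i) t) \<in> S"
  shows "(\<lambda>i. poly (L i) 0) \<in> zariski_closure S"
  unfolding hull_def
proof (intro InterI, clarify)
  fix Z assume Z: "zariski_closed Z" "S \<subseteq> Z"
  obtain P where P: "Z = {x. \<forall>p\<in>P. mpoly_eval p x = (0::'a)}"
    using Z(1) unfolding zariski_closed_def by blast
  have "mpoly_eval p (\<lambda>i. poly (L i) 0) = 0" if "p \<in> P" for p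
  proof -
    \<comment> \<open>\<open>Q\<close> is \<open>p\<close> restricted to the curve, as a polynomial
      in the parameter.\<close>
    define Q where "Q = (\<Sum>m\<in>Poly_Mapping.keys p.
      [:Poly_Mapping.lookup p m:] * (\<Prod>i\<in>UNIV. L i ^ Poly_Mapping.lookup m i))"
    have Q: "mpoly_eval p (\<lambda>i. poly (L i) t) = poly Q t" for t
      by (simp add: mpoly_eval_def Q_def poly_sum poly_prod)
    have "poly Q t = 0" if "t \<noteq> 0" for t
      using curve[OF that] Z(2) \<open>p \<in> P\<close> unfolding Q[symmetric] P by blast
    then have "UNIV - {0} \<subseteq> {t. poly Q t = 0}"
      by blast
    then have "infinite {t. poly Q t = 0}"
      using inf by (meson finite.emptyI finite_Diff2 finite_insert finite_subset)
    then have "Q = 0"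
      using poly_roots_finite by blast
    then show ?thesis
      by (simp add: Q)
  qed
  then show "(\<lambda>i. poly (L i) 0) \<in> Z"
    by (simp add: P)
qed

text \<open>The second form cancels equal summands inside the right-nested sums that
  \<open>algebra_simps\<close> leaves.\<close>

lemma add_self_CHAR_2:
  fixes x y :: "'a::ring_1"
  assumes "CHAR('a) = 2"
  shows "x + x = 0" "x + (x + y) = y"
proof -
  show "x + x = 0"
    using uminus_CHAR_2[OF assms, of x] by (metis add.right_inverse)
  then show "x + (x + y) = y"
    by (simp add: add.assoc[symmetric])
qed

section \<open>Change of basis and the orbit\<close>

context based_space
begin

lemma \<Theta>_inv_\<Theta>: "algebra_structure \<mu> \<Longrightarrow> \<Theta>_inv (\<Theta> \<mu>) = \<mu>"
  unfolding \<Theta>_inv_def using bij_betw_\<Theta>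
  by (intro the_inv_into_f_f) (auto simp: bij_betw_def)

lemma \<Theta>_apply: "\<Theta> \<mu> (i, j, k) = coord e (\<mu> (e i) (e j)) k"
  by (simp add: \<Theta>_def structure_vector_def)

lemma coord_eqI: "(\<And>i. coord e u i = coord e v i) \<Longrightarrow> u = v"
  by (metis (no_types, lifting) coord_expand sum.cong)

lemma coord_change_basis: "coord e (change_basis g j) i = g $ i $ j"
  by (simp add: change_basis_def coord_sum coord_scale coord_basis
      if_distrib[of "(*) _"] cong: if_cong)

lemma coord_product:
  assumes "algebra_structure \<mu>"
  shows "coord e (\<mu> u v) k =
    (\<Sum>i\<in>UNIV. \<Sum>j\<in>UNIV. coord e u i * coord e v j * \<Theta> \<mu> (i, j, k))"
  by (subst algebra_structure_eq_bilinear_extension[OF assms])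
    (simp add: bilinear_extension_def coord_sum coord_scale \<Theta>_apply)

text \<open>In \<open>e\<close>-coordinates the combination is \<open>g\<close> applied to the
  coefficient vector, and an invertible matrix has trivial kernel.\<close>

lemma change_basis_trivial_combination:
  assumes "invertible g" "(\<Sum>j\<in>UNIV. c j \<odot> change_basis g j) = 0"
  shows "c j = 0"
proof -
  have "g *v (\<chi> j. c j) = 0"
  proof -
    have "coord e (\<Sum>j\<in>UNIV. c j \<odot> change_basis g j) i = (g *v (\<chi> j. c j)) $ i" for i
      by (simp add: coord_sum coord_scale coord_change_basis matrix_vector_mult_def mult.commute)
    then show ?thesis
      using assms(2) by (simp add: vec_eq_iff coord_zero)
  qed
  then have "(\<chi> j. c j) = 0"
    using assms(1) by (metis invertible_def matrix_left_invertible_ker)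
  then show ?thesis
    by (simp add: vec_eq_iff)
qed

lemma inj_change_basis:
  assumes "invertible g"
  shows "inj (change_basis g)"
proof (rule injI, rule ccontr)
  fix i j :: 3 assume *: "change_basis g i = change_basis g j" "i \<noteq> j"
  \<comment> \<open>If two columns agreed, the difference of two unit vectors would be a nontrivial
    relation.\<close>
  let ?c = "\<lambda>k. (if k = i then 1 else 0) - (if k = j then 1 else 0) :: 'a"
  have "(\<Sum>k\<in>UNIV. ?c k \<odot> change_basis g k) = 0"
    using *(1) by (simp add: scale_left_diff_distrib sum_subtractf
        if_distrib[of "\<lambda>c. scale c _"] cong: if_cong)
  from change_basis_trivial_combination[OF assms this, of i] *(2) show False
    by simp
qed

lemma independent_change_basis:
  assumes "invertible g"
  shows "independent (range (change_basis g))"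
proof -
  have "c (change_basis g j) = 0"
    if "(\<Sum>v\<in>range (change_basis g). c v \<odot> v) = 0" for c j
    using that change_basis_trivial_combination[OF assms, of "\<lambda>j. c (change_basis g j)"]
    by (simp add: sum.reindex[OF inj_change_basis[OF assms]])
  then show ?thesis
    by (intro independent_if_scalars_zero) auto
qed

lemma coord_change_basis_combination:
  assumes "invertible g"
  shows "coord (change_basis g) (\<Sum>j\<in>UNIV. c j \<odot> change_basis g j) i = c i"
proof -
  note ind = independent_change_basis[OF assms]
  have "coord (change_basis g) (\<Sum>j\<in>UNIV. c j \<odot> change_basis g j) i =
      (\<Sum>j\<in>UNIV. representation (range (change_basis g)) (c j \<odot> change_basis g j) (change_basis g i))"
    unfolding coord_def by (subst representation_sum[OF ind]) (simp_all add: span_scale span_base)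
  also have "\<dots> = (\<Sum>j\<in>UNIV. c j * (if i = j then 1 else 0))"
    by (intro sum.cong refl, subst representation_scale[OF ind])
      (auto simp: span_base representation_basis[OF ind] inj_eq[OF inj_change_basis[OF assms]])
  finally show ?thesis
    by (simp add: if_distrib[of "(*) _"] cong: if_cong)
qed

lemma act_\<Theta>:
  "algebra_structure \<mu> \<Longrightarrow> act (\<Theta> \<mu>) g (i, j, k) =
    coord (change_basis g) (\<mu> (change_basis g i) (change_basis g j)) k"
  by (simp add: act_def structure_vector_def \<Theta>_inv_\<Theta>)

text \<open>Both sides of the last premise are the \<open>e\<close>-coordinates of one product of
  new basis vectors. Comparing there avoids the inverse of \<open>g\<close>.\<close>

lemma act_eqI:
  assumes "algebra_structure \<mu>" "invertible g"
    and "\<And>i j k. (\<Sum>a\<in>UNIV. \<Sum>b\<in>UNIV. g $ a $ i * g $ b $ j * \<Theta> \<mu> (a, b, k)) =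
      (\<Sum>l\<in>UNIV. \<gamma> (i, j, l) * g $ k $ l)"
  shows "act (\<Theta> \<mu>) g = \<gamma>"
proof (rule ext, clarify)
  fix i j k
  have "\<mu> (change_basis g i) (change_basis g j) = (\<Sum>l\<in>UNIV. \<gamma> (i, j, l) \<odot> change_basis g l)"
    by (rule coord_eqI)
      (simp add: coord_product[OF assms(1)] coord_change_basis coord_sum coord_scale assms(3))
  then show "act (\<Theta> \<mu>) g (i, j, k) = \<gamma> (i, j, k)"
    by (simp add: act_\<Theta>[OF assms(1)] coord_change_basis_combination[OF assms(2)])
qed

text \<open>The columns of \<open>g t\<close> are the moving basis and \<open>P\<close> holds its
  structure constants. Only \<open>P\<close> is evaluated at \<open>t = 0\<close>, where
  \<open>g\<close> may become singular.\<close>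

lemma degeneratesI:
  fixes g :: "'a \<Rightarrow> 'a^3^3" and P :: "3 \<Rightarrow> 3 \<Rightarrow> 3 \<Rightarrow> 'a poly"
  assumes "infinite (UNIV :: 'a set)" "algebra_structure \<mu>"
    and "\<And>t. t \<noteq> 0 \<Longrightarrow> det (g t) \<noteq> 0"
    and "\<And>t. t \<noteq> 0 \<Longrightarrow> \<forall>i j k.
      (\<Sum>a\<in>UNIV. \<Sum>b\<in>UNIV. g t $ a $ i * g t $ b $ j * \<Theta> \<mu> (a, b, k)) =
      (\<Sum>l\<in>UNIV. poly (P i j l) t * g t $ k $ l)"
    and "\<forall>i j k. poly (P i j k) 0 = \<Theta> \<nu> (i, j, k)"
  shows "degenerates \<mu> \<nu>"
proof -
  let ?L = "\<lambda>(i, j, k). P i j k"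
  have "(\<lambda>q. poly (?L q) t) \<in> orbit (\<Theta> \<mu>)" if "t \<noteq> 0" for t
  proof -
    have "act (\<Theta> \<mu>) (g t) = (\<lambda>q. poly (?L q) t)"
      by (rule act_eqI) (use assms that in \<open>simp_all add: invertible_det_nz\<close>)
    then show ?thesis
      using assms(3)[OF that] unfolding orbit_def invertible_det_nz[symmetric]
      by (metis (mono_tags, lifting) mem_Collect_eq)
  qed
  from polynomial_curve_limit_in_zariski_closure[OF assms(1) this]
  have "(\<lambda>q. poly (?L q) 0) \<in> zariski_closure (orbit (\<Theta> \<mu>))" .
  moreover have "(\<lambda>q. poly (?L q) 0) = \<Theta> \<nu>"
    using assms(5) by auto
  ultimately show ?thesis
    by (simp add: degenerates_def)
qed

section \<open>Structure vectors of the listed algebras\<close>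

lemmas algebra_defs = alg_a0_def alg_c1_def alg_c3_def alg_a_def alg_l1_def alg_c5_def

lemma algebra_structure_algebras [simp]:
  "algebra_structure alg_a0" "algebra_structure alg_c1" "algebra_structure alg_c3"
  "algebra_structure (alg_a \<delta>)" "algebra_structure alg_l1" "algebra_structure alg_c5"
  by (simp_all add: algebra_defs algebra_structure_bilinear_extension)

lemma coord_neg: "coord e (- v) i = - coord e v i"
  using coord_diff[of 0 v i] by (simp add: coord_zero)

lemma \<Theta>_algebras:
  "\<Theta> alg_a0 (i, j, k) = 0"
  "\<Theta> alg_c1 (i, j, k) = (if i = 3 \<and> j = 3 \<and> k = 1 then 1 else 0)"
  "\<Theta> alg_c3 (i, j, k) = (if (i = 2 \<and> j = 2 \<or> i = 3 \<and> j = 3) \<and> k = 1 then 1 else 0)"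
  "\<Theta> (alg_a \<delta>) (i, j, k) = (if i = 2 \<and> (j = 2 \<or> j = 3) \<and> k = 1 then 1
     else if i = 3 \<and> j = 3 \<and> k = 1 then \<delta> else 0)"
  "\<Theta> alg_l1 (i, j, k) = (if i = 2 \<and> j = 3 \<and> k = 1 then 1
     else if i = 3 \<and> j = 2 \<and> k = 1 then - 1 else 0)"
  "\<Theta> alg_c5 (i, j, k) = (if i = 1 \<and> j = 1 \<and> k = 2 then 1
     else if (i = 1 \<and> j = 2 \<or> i = 2 \<and> j = 1) \<and> k = 3 then 1 else 0)"
  by (auto simp: \<Theta>_apply algebra_defs bilinear_extension_basis coord_zero coord_basis
      coord_scale coord_neg)

section \<open>Degenerations by explicit curves\<close>

text \<open>Here \<open>mat t\<close> scales the basis by \<open>t\<close>: products gain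
  \<open>t^2\<close>, so structure constants gain \<open>t\<close>.\<close>

lemma algebra_structure_degenerates_a0:
  assumes "infinite (UNIV :: 'a set)" "algebra_structure \<mu>"
  shows "degenerates \<mu> alg_a0"
  by (rule degeneratesI[where g = mat and P = "\<lambda>i j k. [:0, \<Theta> \<mu> (i, j, k):]", OF assms])
    (simp_all add: \<Theta>_algebras det_3 mat_def if_distrib[of "(*) _"]
      if_distrib[of "\<lambda>c. c * _"] cong: if_cong)

text \<open>Shrinking \<open>e 2\<close> to \<open>t e 2\<close> turns its square into
  \<open>t^2 e 1\<close>.\<close>

lemma alg_c3_degenerates_c1:
  assumes "infinite (UNIV :: 'a set)"
  shows "degenerates alg_c3 alg_c1"
  by (rule degeneratesI[where g = "\<lambda>t. vector [vector [1, 0, 0], vector [0, t, 0], vector [0, 0, 1]]"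
        and P = "\<lambda>i j k. if i = 2 \<and> j = 2 \<and> k = 1 then [:0, 0, 1:]
          else if i = 3 \<and> j = 3 \<and> k = 1 then 1 else 0", OF assms])
    (simp_all add: \<Theta>_algebras det_3 sum_3 forall_3 power2_eq_square)

text \<open>The basis is \<open>e 1\<close>, \<open>t e 3\<close>, \<open>e 2\<close>: the square of
  \<open>e 2\<close> survives, all other products vanish with \<open>t\<close>.\<close>

lemma alg_a_degenerates_c1:
  assumes "infinite (UNIV :: 'a set)"
  shows "degenerates (alg_a \<delta>) alg_c1"
  by (rule degeneratesI[where g = "\<lambda>t. vector [vector [1, 0, 0], vector [0, 0, 1], vector [0, t, 0]]"
        and P = "\<lambda>i j k. if k \<noteq> 1 then 0 else if i = 3 \<and> j = 3 then 1
          else if i = 3 \<and> j = 2 then [:0, 1:]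
          else if i = 2 \<and> j = 2 then [:0, 0, \<delta>:] else 0", OF assms])
    (simp_all add: \<Theta>_algebras det_3 sum_3 forall_3 power2_eq_square)

text \<open>The basis is \<open>t^2 e 2\<close>, \<open>e 3\<close>, \<open>t e 1\<close>: the third
  vector squares to the first, and their products are \<open>t^3\<close> times the second.\<close>

lemma alg_c5_degenerates_c1:
  assumes "infinite (UNIV :: 'a set)"
  shows "degenerates alg_c5 alg_c1"
  by (rule degeneratesI[where g = "\<lambda>t. vector [vector [0, 0, t], vector [t^2, 0, 0], vector [0, 1, 0]]"
        and P = "\<lambda>i j k. if i = 3 \<and> j = 3 \<and> k = 1 then 1
          else if (i = 1 \<and> j = 3 \<or> i = 3 \<and> j = 1) \<and> k = 2 then [:0, 0, 0, 1:] else 0", OF assms])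
    (simp_all add: \<Theta>_algebras det_3 sum_3 forall_3 power2_eq_square)

text \<open>The basis is \<open>v1 = t e 1\<close>, \<open>v2 = e 2 + (1 + t) e 3\<close>,
  \<open>v3 = e 2 + e 3\<close>. In characteristic 2, \<open>v3\<close> is isotropic,
  \<open>v2 v3 = v3 v2 = v1\<close> and \<open>v2 v2 = t v1\<close>.\<close>

lemma alg_c3_degenerates_l1:
  assumes "infinite (UNIV :: 'a set)" and char: "CHAR('a) = 2"
  shows "degenerates alg_c3 alg_l1"
proof -
  note char2 = add_self_CHAR_2[OF char] uminus_CHAR_2[OF char] minus_CHAR_2[OF char]
  show ?thesis
    by (rule degeneratesI[where g = "\<lambda>t. vector [vector [t, 0, 0], vector [0, 1, 1], vector [0, 1 + t, 1]]"
          and P = "\<lambda>i j k. if k \<noteq> 1 then 0 else if i = 2 \<and> j = 2 then [:0, 1:]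
            else if i = 2 \<and> j = 3 \<or> i = 3 \<and> j = 2 then 1 else 0", OF assms(1)])
      (simp_all add: \<Theta>_algebras det_3 sum_3 forall_3 power2_eq_square algebra_simps char2)
qed

text \<open>The basis is \<open>v1 = t e 3\<close>, \<open>v2 = t e 1\<close>,
  \<open>v3 = e 2\<close>, with \<open>v2 v3 = v3 v2 = v1\<close> and \<open>v2 v2 = t^2 v3\<close>.
  Characteristic 2 identifies the limit with \<open>alg_l1\<close>, as
  \<open>-1 = 1\<close>.\<close>

lemma alg_c5_degenerates_l1:
  assumes "infinite (UNIV :: 'a set)" and char: "CHAR('a) = 2"
  shows "degenerates alg_c5 alg_l1"
  by (rule degeneratesI[where g = "\<lambda>t. vector [vector [0, t, 0], vector [0, 0, 1], vector [t, 0, 0]]"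
        and P = "\<lambda>i j k. if i = 2 \<and> j = 2 \<and> k = 3 then [:0, 0, 1:]
          else if (i = 2 \<and> j = 3 \<or> i = 3 \<and> j = 2) \<and> k = 1 then 1 else 0", OF assms(1)])
    (simp_all add: \<Theta>_algebras det_3 sum_3 forall_3 power2_eq_square uminus_CHAR_2[OF char])

text \<open>The basis is \<open>v1 = t^2 e 3\<close>, \<open>v2 = t e 1\<close>,
  \<open>v3 = t (e 1 + e 2 + e 3)\<close>. In characteristic 2,
  \<open>v2 v2 = v3 v3 = t^2 e 2 = v1 + t (v2 + v3)\<close> and
  \<open>v2 v3 = v3 v2 = t (v2 + v3)\<close>.\<close>

lemma alg_c5_degenerates_c3:
  assumes "infinite (UNIV :: 'a set)" and char: "CHAR('a) = 2"
  shows "degenerates alg_c5 alg_c3"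
proof -
  note char2 = add_self_CHAR_2[OF char] uminus_CHAR_2[OF char] minus_CHAR_2[OF char]
  show ?thesis
    by (rule degeneratesI[where g = "\<lambda>t. vector [vector [0, t, t], vector [0, 0, t], vector [t^2, 0, t]]"
          and P = "\<lambda>i j k. if i = 1 \<or> j = 1 then 0 else if k = 1 then (if i = j then 1 else 0)
            else [:0, 1:]", OF assms(1)])
      (simp_all add: \<Theta>_algebras det_3 sum_3 forall_3 power2_eq_square algebra_simps char2)
qed

section \<open>Closed conditions inherited by degenerations\<close>

text \<open>No hypothesis on \<open>u\<close> is required, because \<open>representation\<close> is zero
  for dependent sets and outside the span.\<close>

lemma coord_scale_any: "coord u (c \<odot> v) k = c * coord u v k"
proof -
  consider "c = 0" | "\<not> independent (range u)" | "independent (range u)" "v \<in> span (range u)"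
    | "c \<noteq> 0" "v \<notin> span (range u)"
    by blast
  then show ?thesis
  proof cases
    case 2
    then show ?thesis
      by (simp add: coord_def representation_def)
  next
    case 4
    \<comment> \<open>Scaling back by the inverse of \<open>c\<close> would put \<open>v\<close>
      into the span.\<close>
    then have "c \<odot> v \<notin> span (range u)"
      by (metis span_scale scale_scale left_inverse scale_one)
    with 4 show ?thesis
      by (simp add: coord_def representation_def)
  qed (simp_all add: coord_def representation_zero representation_scale)
qed

text \<open>Orbit points are structure vectors of \<open>\<mu>\<close> relative to bases, which are
  among the families \<open>v\<close> of the last premise.\<close>

lemma degenerates_polynomial_eq:
  assumes "degenerates \<mu> \<nu>" "algebra_structure \<mu>" "polynomial_function F" "polynomial_function G"
    and "\<And>v. F (structure_vector v \<mu>) = G (structure_vector v \<mu>)"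
  shows "F (\<Theta> \<nu>) = G (\<Theta> \<nu>)"
  using assms(1) unfolding degenerates_def
  by (rule polynomial_eq_on_zariski_closure)
    (auto simp: orbit_def act_def \<Theta>_inv_\<Theta> assms)

lemma algebra_products:
  "alg_a0 u v = 0"
  "alg_c1 u v = (coord e u 3 * coord e v 3) \<odot> e 1"
  "alg_c3 u v = (coord e u 2 * coord e v 2 + coord e u 3 * coord e v 3) \<odot> e 1"
  "alg_a \<delta> u v = (coord e u 2 * coord e v 2 + \<delta> * (coord e u 3 * coord e v 3)
    + coord e u 2 * coord e v 3) \<odot> e 1"
  "alg_l1 u v = (coord e u 2 * coord e v 3 - coord e u 3 * coord e v 2) \<odot> e 1"
  "alg_c5 u v = (coord e u 1 * coord e v 1) \<odot> e 2
      + (coord e u 1 * coord e v 2 + coord e u 2 * coord e v 1) \<odot> e 3"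
  by (simp_all add: algebra_defs bilinear_extension_def sum_3 scale_left_distrib
      scale_left_diff_distrib mult_ac)

lemma structure_vector_algebras:
  "structure_vector w alg_a0 (i, j, k) = 0"
  "structure_vector w alg_c1 (i, j, k) = coord e (w i) 3 * coord e (w j) 3 * coord w (e 1) k"
  "structure_vector w alg_c3 (i, j, k) =
    (coord e (w i) 2 * coord e (w j) 2 + coord e (w i) 3 * coord e (w j) 3) * coord w (e 1) k"
  "structure_vector w (alg_a \<delta>) (i, j, k) =
    (coord e (w i) 2 * coord e (w j) 2 + \<delta> * (coord e (w i) 3 * coord e (w j) 3)
      + coord e (w i) 2 * coord e (w j) 3) * coord w (e 1) k"
  "structure_vector w alg_l1 (i, j, k) =
    (coord e (w i) 2 * coord e (w j) 3 - coord e (w i) 3 * coord e (w j) 2) * coord w (e 1) k"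
  by (simp_all only: structure_vector_def prod.case algebra_products coord_scale_any)
    (simp add: coord_def representation_zero)

lemma alg_a0_degenerates_imp:
  assumes "degenerates alg_a0 \<nu>"
  shows "\<Theta> \<nu> (i, j, k) = 0"
  by (rule degenerates_polynomial_eq[where F = "\<lambda>x. x (i, j, k)" and G = "\<lambda>x. 0", OF assms])
    (simp_all add: polynomial_function_intros structure_vector_algebras)

lemma commutative_degenerates_imp:
  assumes "degenerates \<mu> \<nu>" "algebra_structure \<mu>" "\<And>u v. \<mu> u v = \<mu> v u"
  shows "\<Theta> \<nu> (i, j, k) = \<Theta> \<nu> (j, i, k)"
  by (rule degenerates_polynomial_eq[where F = "\<lambda>x. x (i, j, k)" and G = "\<lambda>x. x (j, i, k)", OF assms(1,2)])
    (simp_all add: polynomial_function_intros structure_vector_def assms(3))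

lemma alternating_degenerates_imp:
  assumes "degenerates \<mu> \<nu>" "algebra_structure \<mu>" "\<And>u. \<mu> u u = 0"
  shows "\<Theta> \<nu> (i, i, k) = 0"
  by (rule degenerates_polynomial_eq[where F = "\<lambda>x. x (i, i, k)", OF assms(1,2)])
    (simp_all add: polynomial_function_intros structure_vector_def assms(3) coord_def representation_zero)

text \<open>With rows \<open>(i, j)\<close> and columns \<open>k\<close> the structure vector is an
  outer product, so its 2 by 2 minors vanish.\<close>

lemma rank_one_product_degenerates_imp:
  assumes "degenerates \<mu> \<nu>" "algebra_structure \<mu>" "\<And>u v. \<mu> u v = B u v \<odot> w"
  shows "\<Theta> \<nu> (i, j, k) * \<Theta> \<nu> (l, m, n) = \<Theta> \<nu> (i, j, n) * \<Theta> \<nu> (l, m, k)"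
  by (rule degenerates_polynomial_eq[where F = "\<lambda>x. x (i, j, k) * x (l, m, n)"
        and G = "\<lambda>x. x (i, j, n) * x (l, m, k)", OF assms(1,2)])
    (simp_all add: polynomial_function_intros structure_vector_def assms(3) coord_scale_any)

text \<open>The form of \<open>alg_c1\<close> is \<open>f u * f v\<close> for a linear functional
  \<open>f\<close>, so its 2 by 2 Gram determinants vanish.\<close>

lemma alg_c1_degenerates_imp:
  assumes "degenerates alg_c1 \<nu>"
  shows "\<Theta> \<nu> (i, i, k) * \<Theta> \<nu> (j, j, k) = \<Theta> \<nu> (i, j, k) * \<Theta> \<nu> (i, j, k)"
  by (rule degenerates_polynomial_eq[where F = "\<lambda>x. x (i, i, k) * x (j, j, k)"
        and G = "\<lambda>x. x (i, j, k) * x (i, j, k)", OF assms])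
    (simp_all add: polynomial_function_intros structure_vector_algebras)

text \<open>For a bilinear form on a plane, both the determinant and the square of the skew part are
  multiplied by the square of the determinant of a base change, so their ratio is invariant.\<close>

lemma discriminant_base_change:
  fixes a b c d w \<delta> :: "'b::comm_ring_1"
  defines "B \<equiv> \<lambda>x y x' y'. x * x' + \<delta> * (y * y') + x * y'"
  shows "(B a b a b * w) * (B c d c d * w) - (B a b c d * w) * (B c d a b * w) =
    \<delta> * ((B a b c d * w - B c d a b * w) * (B a b c d * w - B c d a b * w))"
proof -
  \<comment> \<open>\<open>B\<close> has Gram matrix with rows \<open>(1, 1)\<close> and
    \<open>(0, \<delta>)\<close>: its determinant is \<open>\<delta>\<close> and its skew part is
    1.\<close>
  have det: "B a b a b * B c d c d - B a b c d * B c d a b = \<delta> * ((a * d - b * c) * (a * d - b * c))"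
    by (simp add: B_def algebra_simps)
  have skew: "B a b c d - B c d a b = a * d - b * c"
    by (simp add: B_def algebra_simps)
  have "(B a b a b * w) * (B c d c d * w) - (B a b c d * w) * (B c d a b * w) =
      (B a b a b * B c d c d - B a b c d * B c d a b) * (w * w)"
    by (simp add: algebra_simps)
  also have "\<dots> = \<delta> * (((a * d - b * c) * w) * ((a * d - b * c) * w))"
    by (simp only: det mult_ac)
  also have "(a * d - b * c) * w = B a b c d * w - B c d a b * w"
    by (simp only: skew[symmetric] left_diff_distrib)
  finally show ?thesis .
qed

lemma alg_a_degenerates_imp:
  assumes "degenerates (alg_a \<delta>) \<nu>"
  shows "\<Theta> \<nu> (i, i, k) * \<Theta> \<nu> (j, j, k) - \<Theta> \<nu> (i, j, k) * \<Theta> \<nu> (j, i, k) =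
    \<delta> * ((\<Theta> \<nu> (i, j, k) - \<Theta> \<nu> (j, i, k)) * (\<Theta> \<nu> (i, j, k) - \<Theta> \<nu> (j, i, k)))"
  by (rule degenerates_polynomial_eq[where F = "\<lambda>x. x (i, i, k) * x (j, j, k) - x (i, j, k) * x (j, i, k)"
        and G = "\<lambda>x. \<delta> * ((x (i, j, k) - x (j, i, k)) * (x (i, j, k) - x (j, i, k)))", OF assms])
    (simp_all only: polynomial_function_intros structure_vector_algebras algebra_structure_algebras
      discriminant_base_change)

section \<open>Exclusion of all other targets\<close>

lemma alg_c3_degenerates_cases:
  assumes "degenerates alg_c3 \<nu>" "\<nu> \<in> algebra_list" "\<nu> \<noteq> alg_c3"
  shows "\<nu> \<in> {alg_l1, alg_c1, alg_a0}"
proof -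
  have "\<Theta> \<nu> (2, 3, 1) = \<Theta> \<nu> (3, 2, 1)"
    by (rule commutative_degenerates_imp[OF assms(1)]) (simp_all add: algebra_products mult.commute)
  moreover have "\<Theta> \<nu> (1, 1, 2) * \<Theta> \<nu> (1, 2, 3) = \<Theta> \<nu> (1, 1, 3) * \<Theta> \<nu> (1, 2, 2)"
    by (rule rank_one_product_degenerates_imp[OF assms(1) _ algebra_products(3)]) simp
  \<comment> \<open>Symmetry excludes every \<open>alg_a\<close>, and the minor excludes
    \<open>alg_c5\<close>.\<close>
  ultimately show ?thesis
    using assms(2,3) by (auto simp: algebra_list_def \<Theta>_algebras)
qed

lemma alg_c5_degenerates_cases:
  assumes "degenerates alg_c5 \<nu>" "\<nu> \<in> algebra_list" "\<nu> \<noteq> alg_c5"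
  shows "\<nu> \<in> {alg_c3, alg_l1, alg_c1, alg_a0}"
proof -
  have "\<Theta> \<nu> (2, 3, 1) = \<Theta> \<nu> (3, 2, 1)"
    by (rule commutative_degenerates_imp[OF assms(1)])
      (simp_all add: algebra_products mult.commute add.commute)
  then show ?thesis
    using assms(2,3) by (auto simp: algebra_list_def \<Theta>_algebras)
qed

lemma alg_a_degenerates_cases:
  assumes "CHAR('a) = 2" "degenerates (alg_a \<delta>) \<nu>" "\<nu> \<in> algebra_list" "\<nu> \<noteq> alg_a \<delta>"
  shows "\<nu> \<in> {alg_c1, alg_a0}"
proof -
  have "\<Theta> \<nu> (1, 1, 2) * \<Theta> \<nu> (1, 2, 3) = \<Theta> \<nu> (1, 1, 3) * \<Theta> \<nu> (1, 2, 2)"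
    by (rule rank_one_product_degenerates_imp[OF assms(2) _ algebra_products(4)]) simp
  then show ?thesis
    \<comment> \<open>The minor excludes \<open>alg_c5\<close>. The discriminant identity at
      \<open>i = 2\<close>, \<open>j = 3\<close>, \<open>k = 1\<close> forces equal parameters for
      another \<open>alg_a\<close> and reads \<open>1 = 0\<close> for \<open>alg_c3\<close> and, in
      characteristic 2, for \<open>alg_l1\<close>.\<close>
    using assms(3,4) alg_a_degenerates_imp[OF assms(2), of 2 1 3]
    by (auto simp: algebra_list_def \<Theta>_algebras uminus_CHAR_2[OF assms(1)])
qed

lemma alg_c1_degenerates_cases:
  assumes "degenerates alg_c1 \<nu>" "\<nu> \<in> algebra_list" "\<nu> \<noteq> alg_c1"
  shows "\<nu> = alg_a0"
proof -
  have "\<Theta> \<nu> (2, 3, 1) = \<Theta> \<nu> (3, 2, 1)"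
    by (rule commutative_degenerates_imp[OF assms(1)]) (simp_all add: algebra_products mult.commute)
  \<comment> \<open>Symmetry excludes every \<open>alg_a\<close>. The Gram determinant with
    \<open>k = 1\<close> excludes \<open>alg_c3\<close> and \<open>alg_l1\<close>, the one with
    \<open>k = 3\<close> excludes \<open>alg_c5\<close>.\<close>
  then show ?thesis
    using assms(2,3) alg_c1_degenerates_imp[OF assms(1), of 2 1 3]
      alg_c1_degenerates_imp[OF assms(1), of 1 3 2]
    by (auto simp: algebra_list_def \<Theta>_algebras)
qed

lemma alg_l1_degenerates_cases:
  assumes "degenerates alg_l1 \<nu>" "\<nu> \<in> algebra_list" "\<nu> \<noteq> alg_l1"
  shows "\<nu> = alg_a0"
proof -
  have "\<Theta> \<nu> (i, i, k) = 0" for i k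
    by (rule alternating_degenerates_imp[OF assms(1)]) (simp_all add: algebra_products mult.commute)
  \<comment> \<open>These squares exclude, in turn, \<open>alg_c5\<close>, then
    \<open>alg_c3\<close> and every \<open>alg_a\<close>, then \<open>alg_c1\<close>.\<close>
  from this[of 1 2] this[of 2 1] this[of 3 1] show ?thesis
    using assms(2,3) by (auto simp: algebra_list_def \<Theta>_algebras)
qed

lemma alg_a0_degenerates_cases:
  assumes "degenerates alg_a0 \<nu>" "\<nu> \<in> algebra_list"
  shows "\<nu> = alg_a0"
  using assms(2) alg_a0_degenerates_imp[OF assms(1), of 1 1 2]
    alg_a0_degenerates_imp[OF assms(1), of 2 2 1] alg_a0_degenerates_imp[OF assms(1), of 3 3 1]
    alg_a0_degenerates_imp[OF assms(1), of 2 3 1]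
  by (auto simp: algebra_list_def \<Theta>_algebras)

end

section \<open>Infinitude of the field and the classification\<close>

text \<open>Over a finite field the product of all \<open>X - a\<close>, plus 1, is nonconstant and
  takes the value 1 everywhere, so it has no root.\<close>

lemma infinite_UNIV_alg_closed_field: "infinite (UNIV :: 'a::alg_closed_field set)"
proof
  assume fin: "finite (UNIV :: 'a set)"
  define p :: "'a poly" where "p = (\<Prod>a\<in>UNIV. [:- a, 1:])"
  have "degree p = card (UNIV :: 'a set)"
    unfolding p_def by (subst degree_prod_sum_eq) auto
  then have "degree (p + 1) > 0"
    using fin by (simp add: degree_add_eq_left finite_UNIV_card_ge_0)
  then obtain x where "poly (p + 1) x = 0"
    using alg_closed_imp_poly_has_root by blast
  moreover have "poly p x = 0"
    using fin by (auto simp: p_def poly_prod)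
  ultimately show False
    by simp
qed

theorem mainTheorem2:
  fixes scale :: "'a::alg_closed_field \<Rightarrow> 'v::ab_group_add \<Rightarrow> 'v"
    and e :: "3 \<Rightarrow> 'v"
    and \<gg> \<hh> :: "'v \<Rightarrow> 'v \<Rightarrow> 'v"
  assumes "CHAR('a) = 2"
    and "based_space scale e"
    and "\<gg> \<in> based_space.algebra_list scale e"
    and "\<hh> \<in> based_space.algebra_list scale e"
    and "\<gg> \<noteq> \<hh>"
  shows "based_space.degenerates scale e \<gg> \<hh> \<longleftrightarrow>
    (\<gg>, \<hh>) \<in>
      {(based_space.alg_c5 scale e, based_space.alg_c3 scale e),
       (based_space.alg_c5 scale e, based_space.alg_l1 scale e),
       (based_space.alg_c5 scale e, based_space.alg_c1 scale e),
       (based_space.alg_c5 scale e, based_space.alg_a0 scale e)}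
    \<union> {(based_space.alg_c3 scale e, based_space.alg_l1 scale e),
       (based_space.alg_c3 scale e, based_space.alg_c1 scale e),
       (based_space.alg_c3 scale e, based_space.alg_a0 scale e)}
    \<union> (\<Union>\<delta>. {(based_space.alg_a scale e \<delta>, based_space.alg_c1 scale e),
            (based_space.alg_a scale e \<delta>, based_space.alg_a0 scale e)})
    \<union> {(based_space.alg_c1 scale e, based_space.alg_a0 scale e),
       (based_space.alg_l1 scale e, based_space.alg_a0 scale e)}"
proof -
  interpret based_space scale e by fact
  note inf = infinite_UNIV_alg_closed_field[where 'a = 'a]
  note pos = algebra_structure_degenerates_a0[OF inf] alg_c3_degenerates_c1[OF inf]
    alg_a_degenerates_c1[OF inf] alg_c5_degenerates_c1[OF inf]
    alg_c3_degenerates_l1[OF inf assms(1)] alg_c5_degenerates_l1[OF inf assms(1)]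
    alg_c5_degenerates_c3[OF inf assms(1)]
  show ?thesis (is "_ \<longleftrightarrow> (\<gg>, \<hh>) \<in> ?pairs")
  proof
    assume deg: "degenerates \<gg> \<hh>"
    consider "\<gg> = alg_a0" | "\<gg> = alg_c1" | "\<gg> = alg_c3" | "\<gg> = alg_l1" | "\<gg> = alg_c5"
      | \<delta> where "\<gg> = alg_a \<delta>"
      using assms(3) by (auto simp: algebra_list_def)
    then show "(\<gg>, \<hh>) \<in> ?pairs"
    proof cases
      \<comment> \<open>The zero algebra reaches only itself, which distinctness rules out.\<close>
      case 1
      then show ?thesis
        using deg assms(4,5) alg_a0_degenerates_cases[of \<hh>] by auto
    next
      case 2
      then show ?thesis
        using deg assms(4,5) alg_c1_degenerates_cases[of \<hh>] by auto
    next
      case 3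
      then show ?thesis
        using deg assms(4,5) alg_c3_degenerates_cases[of \<hh>] by auto
    next
      case 4
      then show ?thesis
        using deg assms(4,5) alg_l1_degenerates_cases[of \<hh>] by auto
    next
      case 5
      then show ?thesis
        using deg assms(4,5) alg_c5_degenerates_cases[of \<hh>] by auto
    next
      case 6
      then show ?thesis
        using deg assms(4,5) alg_a_degenerates_cases[OF assms(1), of \<delta> \<hh>] by auto
    qed
  next
    assume "(\<gg>, \<hh>) \<in> ?pairs"
    then show "degenerates \<gg> \<hh>"
      using pos by auto
  qed
qed

end
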